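(* Let $\Omega\subseteq\mathbb{R}^n$ be open, $p\in\mathbb{N}$, $\rho,\delta\in[0,1]$, and let $(m_j)_{j\in\mathbb{N}}$ be a sequence of real numbers with $m_j\searrow-\infty$ and $m_0=m$. (i) Let $\{(a_{j,\varepsilon})_\varepsilon\}_{j\in\mathbb{N}}$ be a sequence with $(a_{j,\varepsilon})_\varepsilon\in\mathcal{M}_{S^{m_j}_{\rho,\delta}(\Omega\times\mathbb{R}^p)}$ for all $j$. Let $(a_\varepsilon)_\varepsilon\in\mathcal{C}^\infty(\Omega\times\mathbb{R}^p)^{(0,1]}$ be such that for all compact $K\subset\Omega$ and all $\alpha\in\mathbb{N}^p,\beta\in\mathbb{N}^n$ there exist $\mu\in\mathbb{R}$ and a moderate net of real numbers $(C_\varepsilon)_\varepsilon$ such that $$|\partial^\alpha_\xi\partial^\beta_xa_\varepsilon(x,\xi)|\le C_\varepsilon\langle\xi\rangle^\mu$$ for all $x\in K$, $\xi\in\mathbb{R}^p$, $\varepsilon\in(0,1]$. Furthermore, assume that for any $r\ge1$ and compact $K\subset\Omega$ there exist $\mu_r=\mu_r(K)\in\mathbb{R}$ and a moderate net of real numbers $(C_{r,\varepsilon})_\varepsilon=(C_{r,\varepsilon}(K))_\varepsilon$ such that $\mu_r\to-\infty$ as $r\to+\infty$ and $$\Big|a_\varepsilon(x,\xi)-\sum_{j=0}^{r-1}a_{j,\varepsilon}(x,\xi)\Big|\le C_{r,\varepsilon}\langle\xi\rangle^{\mu_r}$$ for all $x\in K$, $\xi\in\mathbb{R}^p$, $\varepsilon\in(0,1]$.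 Then $(a_\varepsilon)_\varepsilon\sim\sum_j(a_{j,\varepsilon})_\varepsilon$. (ii) If in (i) one assumes instead that $(a_{j,\varepsilon})_\varepsilon\in\mathcal{M}^{\mathrm{sc}}_{S^{m_j}_{\rho,\delta}(\Omega\times\mathbb{R}^p)}$ for all $j$ and that all the nets $(C_\varepsilon)_\varepsilon$ and $(C_{r,\varepsilon})_\varepsilon$ are of slow scale type, then $(a_\varepsilon)_\varepsilon\sim_{\mathrm{sc}}\sum_j(a_{j,\varepsilon})_\varepsilon$.
   Context: $\langle\xi\rangle=(1+|\xi|^2)^{1/2}$. A net $(C_\varepsilon)_{\varepsilon\in(0,1]}$ of numbers is moderate if $|C_\varepsilon|=O(\varepsilon^{-N})$ as $\varepsilon\to0$ for some $N\in\mathbb{N}$. A slow scale net is a net $(\lambda_\varepsilon)_\varepsilon$ of positive reals with $\inf_\varepsilon\lambda_\varepsilon\ne0$ such that for every $q\ge0$ there is $c_q>0$ with $\lambda_\varepsilon^q\le c_q\varepsilon^{-1}$ for all $\varepsilon\in(0,1]$; a net $(C_\varepsilon)_\varepsilon$ is of slow scale type if $|C_\varepsilon|=O(\lambda_\varepsilon)$ as $\varepsilon\to0$ for some slow scale net. $S^m_{\rho,\delta}(\Omega\times\mathbb{R}^p)$ is the Hörmander symbol space with seminorms $|a|^{(m)}_{\rho,\delta,K,j}=\sup_{x\in K,\xi\in\mathbb{R}^p}\sup_{|\alpha+\beta|\le j}|\partial^\alpha_\xi\partial^\beta_xa(x,\xi)|\langle\xi\rangle^{-m+\rho|\alpha|-\delta|\beta|}$,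 $K\subset\Omega$ compact, $j\in\mathbb{N}$. For a locally convex space $E$ with seminorms $(p_i)$, $\mathcal{M}_E$ is the set of $(u_\varepsilon)_\varepsilon\in E^{(0,1]}$ such that for all $i$ there is $N\in\mathbb{N}$ with $p_i(u_\varepsilon)=O(\varepsilon^{-N})$ as $\varepsilon\to0$, and $\mathcal{M}^{\mathrm{sc}}_E$ is the set of those such that for all $i$ there is a slow scale net $(\lambda_\varepsilon)_\varepsilon$ with $p_i(u_\varepsilon)=O(\lambda_\varepsilon)$. Asymptotic expansions: for $(a_\varepsilon)_\varepsilon\in\mathcal{C}^\infty(\Omega\times\mathbb{R}^p)^{(0,1]}$ and $(a_{j,\varepsilon})_\varepsilon\in\mathcal{M}_{S^{m_j}_{\rho,\delta}(\Omega\times\mathbb{R}^p)}$, $(a_\varepsilon)_\varepsilon\sim\sum_j(a_{j,\varepsilon})_\varepsilon$ means that for all $r\ge1$, $\big(a_\varepsilon-\sum_{j=0}^{r-1}a_{j,\varepsilon}\big)_\varepsilon\in\mathcal{M}_{S^{m_r}_{\rho,\delta}(\Omega\times\mathbb{R}^p)}$. For $(a_{j,\varepsilon})_\varepsilon\in\mathcal{M}^{\mathrm{sc}}_{S^{m_j}_{\rho,\delta}(\Omega\times\mathbb{R}^p)}$, $(a_\varepsilon)_\varepsilon\sim_{\mathrm{sc}}\sum_j(a_{j,\varepsilon})_\varepsilon$ means the same with $\mathcal{M}^{\mathrm{sc}}_{S^{m_r}_{\rho,\delta}(\Omega\times\mathbb{R}^p)}$. *)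

theory Defs
  imports "HOL-Analysis.Analysis" "HOL-Library.Landau_Symbols"
begin

section \<open>Nets indexed by the interval (0,1]\<close>

text \<open>A net indexed by (0,1] is a function on the reals of which only the values on
  \<open>{0<..1}\<close> matter; asymptotics as the parameter tends to 0 are taken along \<open>at_right 0\<close>.\<close>

definition moderate_net :: "(real \<Rightarrow> real) \<Rightarrow> bool" where
  "moderate_net C \<longleftrightarrow> (\<exists>N::nat. C \<in> O[at_right 0](\<lambda>\<epsilon>. 1 / \<epsilon> ^ N))"

definition slow_scale_net :: "(real \<Rightarrow> real) \<Rightarrow> bool" where
  "slow_scale_net l \<longleftrightarrow>
     (\<forall>\<epsilon>\<in>{0<..1}. l \<epsilon> > 0) \<and>
     (INF \<epsilon>\<in>{0<..1}. l \<epsilon>) \<noteq> 0 \<and>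
     (\<forall>q::real. q \<ge> 0 \<longrightarrow> (\<exists>c>0. \<forall>\<epsilon>\<in>{0<..1}. l \<epsilon> powr q \<le> c * inverse \<epsilon>))"

definition slow_scale_type :: "(real \<Rightarrow> real) \<Rightarrow> bool" where
  "slow_scale_type C \<longleftrightarrow> (\<exists>l. slow_scale_net l \<and> C \<in> O[at_right 0](l))"

text \<open>\<open>\<M>\<^sub>E\<close> and its slow scale variant for a locally convex space with carrier \<open>E\<close> and
  seminorms \<open>P i\<close>, \<open>i \<in> I\<close>.\<close>

definition moderate_nets_of :: "'e set \<Rightarrow> 'i set \<Rightarrow> ('i \<Rightarrow> 'e \<Rightarrow> real) \<Rightarrow> (real \<Rightarrow> 'e) set" where
  "moderate_nets_of E I P =
     {u. (\<forall>\<epsilon>\<in>{0<..1}. u \<epsilon> \<in> E) \<and> (\<forall>i\<in>I. moderate_net (\<lambda>\<epsilon>. P i (u \<epsilon>)))}"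

definition slow_scale_nets_of :: "'e set \<Rightarrow> 'i set \<Rightarrow> ('i \<Rightarrow> 'e \<Rightarrow> real) \<Rightarrow> (real \<Rightarrow> 'e) set" where
  "slow_scale_nets_of E I P =
     {u. (\<forall>\<epsilon>\<in>{0<..1}. u \<epsilon> \<in> E) \<and> (\<forall>i\<in>I. slow_scale_type (\<lambda>\<epsilon>. P i (u \<epsilon>)))}"

section \<open>Partial derivatives and smooth functions\<close>

definition partial_deriv ::
    "'a::euclidean_space \<Rightarrow> ('a \<Rightarrow> 'b::real_normed_vector) \<Rightarrow> 'a \<Rightarrow> 'b" where
  "partial_deriv e f z = frechet_derivative f (at z) e"

text \<open>\<open>C_k_on k U f\<close>: \<open>f\<close> is \<open>k\<close> times continuously differentiable on \<open>U\<close>, for open \<open>U\<close>.\<close>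

primrec C_k_on ::
    "nat \<Rightarrow> 'a::euclidean_space set \<Rightarrow> ('a \<Rightarrow> 'b::real_normed_vector) \<Rightarrow> bool" where
  "C_k_on 0 U f \<longleftrightarrow> continuous_on U f"
| "C_k_on (Suc k) U f \<longleftrightarrow>
     (\<forall>z\<in>U. f differentiable (at z)) \<and> (\<forall>e\<in>Basis. C_k_on k U (partial_deriv e f))"

definition smooth_on ::
    "'a::euclidean_space set \<Rightarrow> ('a \<Rightarrow> 'b::real_normed_vector) \<Rightarrow> bool" where
  "smooth_on U f \<longleftrightarrow> (\<forall>k. C_k_on k U f)"

text \<open>A fixed enumeration of the coordinates, determining the order in which the iterated
  partial derivatives of a multi-index are taken. On smooth functions the order is
  irrelevant.\<close>

definition coords :: "'i::finite list" where
  "coords = (SOME is. distinct is \<and> set is = UNIV)"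

definition multi_deriv ::
    "('i::finite \<Rightarrow> 'a::euclidean_space) \<Rightarrow> ('i \<Rightarrow> nat) \<Rightarrow>
     ('a \<Rightarrow> 'b::real_normed_vector) \<Rightarrow> 'a \<Rightarrow> 'b" where
  "multi_deriv e \<alpha> f = foldr (\<lambda>i. partial_deriv (e i) ^^ \<alpha> i) coords f"

text \<open>\<open>sym_deriv \<alpha> \<beta> a\<close> is \<open>\<partial>\<^sub>\<xi>\<^sup>\<alpha> \<partial>\<^sub>x\<^sup>\<beta> a\<close>
  for a function \<open>a\<close> of \<open>(x, \<xi>)\<close>.\<close>

definition sym_deriv ::
    "('p::finite \<Rightarrow> nat) \<Rightarrow> ('n::finite \<Rightarrow> nat) \<Rightarrow> ((real^'n) \<times> (real^'p) \<Rightarrow> complex) \<Rightarrow>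
     (real^'n) \<times> (real^'p) \<Rightarrow> complex" where
  "sym_deriv \<alpha> \<beta> a =
     multi_deriv (\<lambda>i. (0, axis i 1)) \<alpha> (multi_deriv (\<lambda>i. (axis i 1, 0)) \<beta> a)"

definition mi_order :: "('i::finite \<Rightarrow> nat) \<Rightarrow> nat" where
  "mi_order \<alpha> = (\<Sum>i\<in>UNIV. \<alpha> i)"

section \<open>Symbols\<close>

definition japanese_bracket :: "'a::real_normed_vector \<Rightarrow> real" where
  "japanese_bracket \<xi> = sqrt (1 + (norm \<xi>)\<^sup>2)"

text \<open>The supremum is taken in \<open>ennreal\<close>, so that it is infinite if the set is unbounded and
  0 for \<open>K = {}\<close>.\<close>

definition symbol_esup ::
    "real \<Rightarrow> real \<Rightarrow> real \<Rightarrow> (real^'n) set \<Rightarrow> nat \<Rightarrow> ((real^'n) \<times> (real^'p) \<Rightarrow> complex) \<Rightarrow> ennreal" where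
  "symbol_esup \<rho> \<delta> m K j a =
     (SUP (x, \<xi>) \<in> K \<times> UNIV. SUP (\<alpha>, \<beta>) \<in> {(\<alpha>, \<beta>). mi_order \<alpha> + mi_order \<beta> \<le> j}.
        ennreal (norm (sym_deriv \<alpha> \<beta> a (x, \<xi>)) *
          japanese_bracket \<xi> powr (- m + \<rho> * real (mi_order \<alpha>) - \<delta> * real (mi_order \<beta>))))"

definition symbol_index :: "(real^'n) set \<Rightarrow> ((real^'n) set \<times> nat) set" where
  "symbol_index \<Omega> = {(K, j). compact K \<and> K \<subseteq> \<Omega>}"

definition symbol_space ::
    "real \<Rightarrow> real \<Rightarrow> (real^'n) set \<Rightarrow> real \<Rightarrow> ((real^'n) \<times> (real^'p) \<Rightarrow> complex) set" where
  "symbol_space \<rho> \<delta> \<Omega> m =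
     {a. smooth_on (\<Omega> \<times> UNIV) a \<and> (\<forall>(K, j)\<in>symbol_index \<Omega>. symbol_esup \<rho> \<delta> m K j a < \<infinity>)}"

definition symbol_seminorm ::
    "real \<Rightarrow> real \<Rightarrow> real \<Rightarrow> (real^'n) set \<times> nat \<Rightarrow> ((real^'n) \<times> (real^'p) \<Rightarrow> complex) \<Rightarrow> real" where
  "symbol_seminorm \<rho> \<delta> m = (\<lambda>(K, j) a. enn2real (symbol_esup \<rho> \<delta> m K j a))"

definition moderate_symbols ::
    "real \<Rightarrow> real \<Rightarrow> (real^'n) set \<Rightarrow> real \<Rightarrow> (real \<Rightarrow> (real^'n) \<times> (real^'p) \<Rightarrow> complex) set" where
  "moderate_symbols \<rho> \<delta> \<Omega> m =
     moderate_nets_of (symbol_space \<rho> \<delta> \<Omega> m) (symbol_index \<Omega>) (symbol_seminorm \<rho> \<delta> m)"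

definition slow_scale_symbols ::
    "real \<Rightarrow> real \<Rightarrow> (real^'n) set \<Rightarrow> real \<Rightarrow> (real \<Rightarrow> (real^'n) \<times> (real^'p) \<Rightarrow> complex) set" where
  "slow_scale_symbols \<rho> \<delta> \<Omega> m =
     slow_scale_nets_of (symbol_space \<rho> \<delta> \<Omega> m) (symbol_index \<Omega>) (symbol_seminorm \<rho> \<delta> m)"

section \<open>Asymptotic expansions\<close>

definition asymp_expansion ::
    "real \<Rightarrow> real \<Rightarrow> (real^'n) set \<Rightarrow> (nat \<Rightarrow> real) \<Rightarrow>
     (real \<Rightarrow> (real^'n) \<times> (real^'p) \<Rightarrow> complex) \<Rightarrow>
     (nat \<Rightarrow> real \<Rightarrow> (real^'n) \<times> (real^'p) \<Rightarrow> complex) \<Rightarrow> bool" where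
  "asymp_expansion \<rho> \<delta> \<Omega> m a as \<longleftrightarrow>
     (\<forall>r\<ge>1. (\<lambda>\<epsilon> z. a \<epsilon> z - (\<Sum>j<r. as j \<epsilon> z)) \<in> moderate_symbols \<rho> \<delta> \<Omega> (m r))"

definition asymp_expansion_sc ::
    "real \<Rightarrow> real \<Rightarrow> (real^'n) set \<Rightarrow> (nat \<Rightarrow> real) \<Rightarrow>
     (real \<Rightarrow> (real^'n) \<times> (real^'p) \<Rightarrow> complex) \<Rightarrow>
     (nat \<Rightarrow> real \<Rightarrow> (real^'n) \<times> (real^'p) \<Rightarrow> complex) \<Rightarrow> bool" where
  "asymp_expansion_sc \<rho> \<delta> \<Omega> m a as \<longleftrightarrow>
     (\<forall>r\<ge>1. (\<lambda>\<epsilon> z. a \<epsilon> z - (\<Sum>j<r. as j \<epsilon> z)) \<in> slow_scale_symbols \<rho> \<delta> \<Omega> (m r))"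

end

theory Submission imports Defs begin

text \<open>
  The statement says that crude information on the remainders
  \<open>b\<^sub>R = a - (\<Sum>j<R. a\<^sub>j)\<close>, namely decay in \<open>\<xi>\<close> of the functions themselves as
  \<open>R\<close> grows and some polynomial growth of every derivative of \<open>a\<close>, already gives symbol estimates
  for all derivatives. The reason is interpolation: a first derivative is controlled by the function and
  its second derivative, through
  \<open>\<bar>\<partial>\<^sub>e f\<bar> \<le> 2 sup \<bar>f\<bar> / t + t sup \<bar>\<partial>\<^sub>e\<^sup>2 f\<bar>\<close>
  on a segment of length \<open>t\<close> (\<open>partial_deriv_interpolation\<close>).

  A derivative of \<open>b\<^sub>R\<close> of given order grows at most like \<open>\<langle>\<xi>\<rangle>\<^sup>\<nu>\<close> on a given compact set, with
  \<open>\<nu>\<close> independent of \<open>R\<close>, because the orders of the \<open>a\<^sub>j\<close> decrease. With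
  \<open>t = d \<langle>\<xi>\<rangle>\<^sup>-\<^sup>\<sigma>\<close> and \<open>\<sigma> \<ge> 0\<close> large, the second term decays as fast as desired; the first one
  then does so too if \<open>f\<close> decays \<open>\<sigma>\<close> orders faster, which a larger \<open>R\<close> provides. The segment
  must stay in a compact set, so each step replaces the compact set by a larger one
  (\<open>weighted_interpolation\<close>). Induction on the order of differentiation
  (\<open>weight_bounded_derivatives_decay\<close>) shows that for every \<open>\<alpha>\<close>, \<open>\<beta>\<close> and every compact set, some
  \<open>\<partial>\<^sub>\<xi>\<^sup>\<alpha> \<partial>\<^sub>x\<^sup>\<beta> b\<^sub>R\<close> with \<open>R \<ge> r\<close> satisfies the estimate wanted for \<open>b\<^sub>r\<close>. The
  difference \<open>b\<^sub>r - b\<^sub>R\<close> is a finite sum of \<open>a\<^sub>j\<close> with \<open>j \<ge> r\<close>, whose symbol estimates are known.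

  Since \<open>t\<close> depends only on \<open>\<xi>\<close> and not on the bounds for \<open>f\<close>, the constants enter linearly: the new
  net of constants is a fixed linear combination of the old ones. The moderate nets and the nets of slow
  scale type are both closed under linear combinations and domination, and both parts of the statement are
  instances of one argument in the locale \<open>net_class\<close>.
\<close>

section \<open>Iterated partial derivatives\<close>

lemma has_derivative_imp_partial_deriv:
  assumes "(f has_derivative f') (at z)"
  shows "partial_deriv e f z = f' e"
  unfolding partial_deriv_def using frechet_derivative_at[OF assms] by simp

lemma differentiable_imp_has_derivative:
  assumes "f differentiable (at z)"
  shows "(f has_derivative frechet_derivative f (at z)) (at z)"
  using assms frechet_derivative_works by blast

lemma partial_deriv_cong_open:
  assumes "open U" "z \<in> U" "\<And>y. y \<in> U \<Longrightarrow> f y = g y" "f differentiable (at z)"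
  shows "g differentiable (at z)" "partial_deriv e g z = partial_deriv e f z"
proof -
  have *: "(g has_derivative frechet_derivative f (at z)) (at z)"
    by (rule has_derivative_transform_within_open[OF differentiable_imp_has_derivative[OF assms(4)] assms(1,2)])
       (use assms(3) in auto)
  show "g differentiable (at z)" using * differentiableI by blast
  show "partial_deriv e g z = partial_deriv e f z"
    using has_derivative_imp_partial_deriv[OF *] by (simp add: partial_deriv_def)
qed

lemma partial_deriv_add_scaled:
  assumes "f differentiable (at z)" "g differentiable (at z)"
  shows "(\<lambda>y. f y + c *\<^sub>R g y) differentiable (at z)"
    and "partial_deriv e (\<lambda>y. f y + c *\<^sub>R g y) z = partial_deriv e f z + c *\<^sub>R partial_deriv e g z"
proof -
  have *: "((\<lambda>y. f y + c *\<^sub>R g y) has_derivative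
     (\<lambda>h. frechet_derivative f (at z) h + c *\<^sub>R frechet_derivative g (at z) h)) (at z)"
    by (intro derivative_intros differentiable_imp_has_derivative assms)
  show "(\<lambda>y. f y + c *\<^sub>R g y) differentiable (at z)" using * differentiableI by blast
  show "partial_deriv e (\<lambda>y. f y + c *\<^sub>R g y) z = partial_deriv e f z + c *\<^sub>R partial_deriv e g z"
    using has_derivative_imp_partial_deriv[OF *] by (simp add: partial_deriv_def)
qed

lemma C_k_on_cong:
  assumes "open U" "\<And>y. y \<in> U \<Longrightarrow> f y = g y" "C_k_on k U f"
  shows "C_k_on k U g"
  using assms(2,3)
proof (induction k arbitrary: f g)
  case 0
  then show ?case using continuous_on_cong[of U U f g] by auto
next
  case (Suc k)
  have d: "f differentiable (at z)" if "z \<in> U" for z using Suc.prems(2) that by simp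
  note c = partial_deriv_cong_open[where f = f and g = g and U = U, OF assms(1) _ Suc.prems(1)]
  have "C_k_on k U (partial_deriv e g)" if "e \<in> Basis" for e
  proof (rule Suc.IH)
    show "partial_deriv e f y = partial_deriv e g y" if "y \<in> U" for y
      using c(2)[OF that] d[OF that] by simp
    show "C_k_on k U (partial_deriv e f)" using Suc.prems(2) that by simp
  qed
  then show ?case using c(1) d by simp
qed

lemma C_k_on_add_scaled:
  assumes "open U" "C_k_on k U f" "C_k_on k U g"
  shows "C_k_on k U (\<lambda>z. f z + c *\<^sub>R g z)"
  using assms(2,3)
proof (induction k arbitrary: f g)
  case 0
  then show ?case by (auto intro!: continuous_intros)
next
  case (Suc k)
  have d: "f differentiable (at z)" "g differentiable (at z)" if "z \<in> U" for z
    using Suc.prems that by simp_all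
  have "C_k_on k U (partial_deriv e (\<lambda>z. f z + c *\<^sub>R g z))" if "e \<in> Basis" for e
  proof (rule C_k_on_cong[OF assms(1), where f = "\<lambda>z. partial_deriv e f z + c *\<^sub>R partial_deriv e g z"])
    show "C_k_on k U (\<lambda>z. partial_deriv e f z + c *\<^sub>R partial_deriv e g z)"
      using Suc.prems that by (intro Suc.IH) simp_all
    show "partial_deriv e f y + c *\<^sub>R partial_deriv e g y = partial_deriv e (\<lambda>z. f z + c *\<^sub>R g z) y"
      if "y \<in> U" for y
      using partial_deriv_add_scaled(2)[OF d[OF that]] by simp
  qed
  then show ?case using partial_deriv_add_scaled(1)[OF d] by simp
qed

lemma smooth_on_add_scaled:
  assumes "open U" "smooth_on U f" "smooth_on U g"
  shows "smooth_on U (\<lambda>z. f z + c *\<^sub>R g z)"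
  unfolding smooth_on_def
proof
  fix k
  show "C_k_on k U (\<lambda>z. f z + c *\<^sub>R g z)"
    using assms(2,3) by (intro C_k_on_add_scaled[OF assms(1)]) (simp_all add: smooth_on_def)
qed

lemma smooth_on_imp_differentiable:
  assumes "smooth_on U f" "z \<in> U"
  shows "f differentiable (at z)"
proof -
  have "C_k_on (Suc 0) U f" using assms(1) by (simp only: smooth_on_def)
  then show ?thesis using assms(2) by simp
qed

lemma smooth_on_partial_deriv:
  assumes "smooth_on U f" "e \<in> Basis"
  shows "smooth_on U (partial_deriv e f)"
  unfolding smooth_on_def
proof
  fix k
  have "C_k_on (Suc k) U f" using assms(1) by (simp only: smooth_on_def)
  then show "C_k_on k U (partial_deriv e f)" using assms(2) by simp
qed

abbreviation iterated_deriv ::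
  "'a::euclidean_space list \<Rightarrow> ('a \<Rightarrow> 'b::real_normed_vector) \<Rightarrow> 'a \<Rightarrow> 'b" where
  "iterated_deriv es f \<equiv> foldr partial_deriv es f"

lemma smooth_on_iterated_deriv:
  assumes "smooth_on U f" "set es \<subseteq> Basis"
  shows "smooth_on U (iterated_deriv es f)"
  using assms(2) by (induction es) (simp_all add: smooth_on_partial_deriv assms(1))

lemma iterated_deriv_add_scaled:
  assumes "open U" "smooth_on U f" "smooth_on U g" "set es \<subseteq> Basis" "z \<in> U"
  shows "iterated_deriv es (\<lambda>z. f z + c *\<^sub>R g z) z = iterated_deriv es f z + c *\<^sub>R iterated_deriv es g z"
  using assms(4,5)
proof (induction es arbitrary: z)
  case (Cons e es)
  have d: "iterated_deriv es f differentiable (at z)" "iterated_deriv es g differentiable (at z)"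
    using Cons.prems smooth_on_iterated_deriv[OF assms(2), of es] smooth_on_iterated_deriv[OF assms(3), of es]
    by (simp_all add: smooth_on_imp_differentiable)
  have "partial_deriv e (iterated_deriv es (\<lambda>z. f z + c *\<^sub>R g z)) z
      = partial_deriv e (\<lambda>z. iterated_deriv es f z + c *\<^sub>R iterated_deriv es g z) z"
  proof (rule partial_deriv_cong_open(2)[OF assms(1) Cons.prems(2)])
    show "iterated_deriv es f y + c *\<^sub>R iterated_deriv es g y = iterated_deriv es (\<lambda>z. f z + c *\<^sub>R g z) y"
      if "y \<in> U" for y
      using Cons.IH[OF _ that] Cons.prems(1) by simp
  qed (rule partial_deriv_add_scaled(1)[OF d])
  then show ?case using partial_deriv_add_scaled(2)[OF d] by simp
qed simp

section \<open>Multi-indices as lists of coordinate directions\<close>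

text \<open>The directions of differentiation in the order in which a multi-index prescribes them, the outermost
  derivative first.\<close>

definition directions :: "('i \<Rightarrow> 'a) \<Rightarrow> ('i \<Rightarrow> nat) \<Rightarrow> 'i list \<Rightarrow> 'a list" where
  "directions e \<alpha> is = concat (map (\<lambda>i. replicate (\<alpha> i) (e i)) is)"

lemma multi_deriv_eq_iterated_deriv:
  "multi_deriv e \<alpha> f = iterated_deriv (directions e \<alpha> coords) f"
proof -
  have "foldr (\<lambda>i. partial_deriv (e i) ^^ \<alpha> i) is f = iterated_deriv (directions e \<alpha> is) f" for "is"
    by (induction "is") (simp_all add: directions_def)
  then show ?thesis by (simp add: multi_deriv_def)
qed

definition symbol_directions ::
  "('p::finite \<Rightarrow> nat) \<Rightarrow> ('n::finite \<Rightarrow> nat) \<Rightarrow> ((real^'n) \<times> (real^'p)) list" where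
  "symbol_directions \<alpha> \<beta> =
     directions (\<lambda>i. (0, axis i 1)) \<alpha> coords @ directions (\<lambda>i. (axis i 1, 0)) \<beta> coords"

lemma sym_deriv_eq_iterated_deriv:
  "sym_deriv \<alpha> \<beta> a = iterated_deriv (symbol_directions \<alpha> \<beta>) a"
  by (simp add: sym_deriv_def symbol_directions_def multi_deriv_eq_iterated_deriv)

lemma symbol_directions_subset_Basis: "set (symbol_directions \<alpha> \<beta>) \<subseteq> Basis"
  by (auto simp: symbol_directions_def directions_def Basis_prod_def axis_in_Basis_iff)

lemma coords_distinct: "distinct (coords :: 'i::finite list)"
proof -
  have "\<exists>is::'i list. distinct is \<and> set is = UNIV"
    using finite_distinct_list[of "UNIV :: 'i set"] by auto
  from someI_ex[OF this] show ?thesis by (simp add: coords_def)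
qed

lemma directions_cong:
  "(\<And>i. i \<in> set is \<Longrightarrow> \<alpha> i = \<alpha>' i) \<Longrightarrow> directions e \<alpha> is = directions e \<alpha>' is"
  unfolding directions_def by (metis (mono_tags, lifting) map_eq_conv)

text \<open>The outermost direction of a multi-index can be removed once, and also applied once more, within the
  prescribed order. Thus a derivative and its two neighbours in that direction are all derivatives in the
  prescribed order, and partial derivatives never have to be interchanged.\<close>

lemma directions_peel:
  assumes "distinct is" "directions e \<alpha> is \<noteq> []"
  shows "\<exists>v \<alpha>\<^sub>1 \<alpha>\<^sub>2. directions e \<alpha> is = v # directions e \<alpha>\<^sub>1 is \<and> directions e \<alpha>\<^sub>2 is = v # directions e \<alpha> is"
  using assms
proof (induction "is")
  case Nil then show ?case by (simp add: directions_def)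
next
  case (Cons i "is")
  have upd: "directions e (\<gamma>(i := k)) (i # is) = replicate k (e i) @ directions e \<gamma> is" for \<gamma> k
  proof -
    have "directions e (\<gamma>(i := k)) is = directions e \<gamma> is"
      using Cons.prems(1) by (intro directions_cong) auto
    then show ?thesis by (simp add: directions_def)
  qed
  have here: "directions e \<gamma> (i # is) = replicate (\<gamma> i) (e i) @ directions e \<gamma> is" for \<gamma>
    by (simp add: directions_def)
  show ?case
  proof (cases "\<alpha> i")
    case 0
    then obtain v \<alpha>\<^sub>1 \<alpha>\<^sub>2 where "directions e \<alpha> is = v # directions e \<alpha>\<^sub>1 is" "directions e \<alpha>\<^sub>2 is = v # directions e \<alpha> is"
      using Cons here by fastforce
    then show ?thesis
      using 0 here[of \<alpha>] upd[of \<alpha>\<^sub>1 0] upd[of \<alpha>\<^sub>2 0] by (metis append_Nil replicate_0)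
  next
    case (Suc k)
    have "directions e \<alpha> (i # is) = e i # directions e (\<alpha>(i := k)) (i # is)"
      using upd[of \<alpha> k] here[of \<alpha>] Suc by simp
    moreover have "directions e (\<alpha>(i := Suc (Suc k))) (i # is) = e i # directions e \<alpha> (i # is)"
      using upd[of \<alpha> "Suc (Suc k)"] here[of \<alpha>] Suc by simp
    ultimately show ?thesis by blast
  qed
qed

lemma symbol_directions_peel:
  fixes \<alpha> :: "'p::finite \<Rightarrow> nat" and \<beta> :: "'n::finite \<Rightarrow> nat"
  assumes "symbol_directions \<alpha> \<beta> \<noteq> []"
  obtains v \<alpha>\<^sub>1 \<beta>\<^sub>1 \<alpha>\<^sub>2 \<beta>\<^sub>2 where
    "symbol_directions \<alpha> \<beta> = v # symbol_directions \<alpha>\<^sub>1 \<beta>\<^sub>1"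
    "symbol_directions \<alpha>\<^sub>2 \<beta>\<^sub>2 = v # symbol_directions \<alpha> \<beta>"
proof (cases "directions (\<lambda>i. (0::real^'n, axis i (1::real)) :: (real^'n) \<times> (real^'p)) \<alpha> coords = []")
  case True
  then have "directions (\<lambda>i. (axis i (1::real), 0) :: (real^'n) \<times> (real^'p)) \<beta> coords \<noteq> []"
    using assms by (simp add: symbol_directions_def)
  from directions_peel[OF coords_distinct this] show ?thesis
    using that[of _ \<alpha> _ \<alpha>] True by (auto simp: symbol_directions_def)
next
  case False
  from directions_peel[OF coords_distinct this] show ?thesis
    using that[of _ _ \<beta> _ \<beta>] by (fastforce simp: symbol_directions_def)
qed

lemma finite_mi_order_le:
  "finite {(\<alpha> :: 'p::finite \<Rightarrow> nat, \<beta> :: 'n::finite \<Rightarrow> nat). mi_order \<alpha> + mi_order \<beta> \<le> j}"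
proof -
  have le: "\<gamma> i \<le> mi_order \<gamma>" for \<gamma> :: "'i::finite \<Rightarrow> nat" and i
    unfolding mi_order_def by (rule member_le_sum) auto
  have fin: "finite {\<gamma> :: 'i::finite \<Rightarrow> nat. \<forall>i. \<gamma> i \<le> j}"
  proof -
    have "{\<gamma> :: 'i \<Rightarrow> nat. \<forall>i. \<gamma> i \<le> j} = PiE UNIV (\<lambda>_. {..j})" by (auto simp: PiE_UNIV_domain)
    then show ?thesis by (simp add: finite_PiE)
  qed
  show ?thesis
    by (rule finite_subset[OF _ finite_cartesian_product[OF fin fin]])
       (auto intro: order_trans[OF le])
qed

section \<open>The weight\<close>

lemma japanese_bracket_ge_1: "japanese_bracket \<xi> \<ge> 1"
  by (simp add: japanese_bracket_def)

lemma japanese_bracket_pos: "japanese_bracket \<xi> > 0"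
  using japanese_bracket_ge_1[of \<xi>] by linarith

lemma japanese_bracket_powr_mono:
  "\<mu> \<le> \<nu> \<Longrightarrow> japanese_bracket \<xi> powr \<mu> \<le> japanese_bracket \<xi> powr \<nu>"
  using japanese_bracket_ge_1 by (intro powr_mono) auto

lemma japanese_bracket_le_double:
  assumes "norm v \<le> 1"
  shows "japanese_bracket (\<xi> + v) \<le> 2 * japanese_bracket \<xi>"
proof -
  have "norm (\<xi> + v) \<le> norm \<xi> + 1" using norm_triangle_ineq[of \<xi> v] assms by linarith
  then have "(norm (\<xi> + v))\<^sup>2 \<le> (norm \<xi> + 1)\<^sup>2" by (intro power_mono) auto
  also have "\<dots> \<le> 2 * (norm \<xi>)\<^sup>2 + 2"
    using sum_squares_bound[of "norm \<xi>" 1] by (simp add: power2_sum)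
  also have "\<dots> \<le> 4 * (norm \<xi>)\<^sup>2 + 2" by simp
  finally have "1 + (norm (\<xi> + v))\<^sup>2 \<le> 4 * (1 + (norm \<xi>)\<^sup>2)" by simp
  then have "sqrt (1 + (norm (\<xi> + v))\<^sup>2) \<le> sqrt (4 * (1 + (norm \<xi>)\<^sup>2))" by (rule real_sqrt_le_mono)
  moreover have "sqrt (4 * (1 + (norm \<xi>)\<^sup>2)) = 2 * sqrt (1 + (norm \<xi>)\<^sup>2)"
    unfolding real_sqrt_mult by simp
  ultimately show ?thesis by (simp only: japanese_bracket_def)
qed

text \<open>Peetre's inequality for shifts of length at most 1: the weight is comparable at neighbouring points,
  for exponents of either sign.\<close>

lemma peetre:
  assumes "norm v \<le> 1"
  shows "japanese_bracket (\<xi> + v) powr \<mu> \<le> 2 powr \<bar>\<mu>\<bar> * japanese_bracket \<xi> powr \<mu>"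
proof (cases "\<mu> \<ge> 0")
  case True
  have "japanese_bracket (\<xi> + v) powr \<mu> \<le> (2 * japanese_bracket \<xi>) powr \<mu>"
    using japanese_bracket_le_double[OF assms] japanese_bracket_pos[of "\<xi> + v"] True
    by (intro powr_mono2) auto
  then show ?thesis using True japanese_bracket_pos[of \<xi>] by (simp add: powr_mult)
next
  case False
  have "japanese_bracket \<xi> \<le> 2 * japanese_bracket (\<xi> + v)"
    using japanese_bracket_le_double[of "- v" "\<xi> + v"] assms by simp
  then have "(2 * japanese_bracket (\<xi> + v)) powr \<mu> \<le> japanese_bracket \<xi> powr \<mu>"
    using japanese_bracket_pos[of \<xi>] False by (intro powr_mono2') auto
  then have *: "2 powr \<mu> * japanese_bracket (\<xi> + v) powr \<mu> \<le> japanese_bracket \<xi> powr \<mu>"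
    using japanese_bracket_pos[of "\<xi> + v"] by (simp add: powr_mult)
  have "japanese_bracket (\<xi> + v) powr \<mu> = 2 powr (-\<mu>) * (2 powr \<mu> * japanese_bracket (\<xi> + v) powr \<mu>)"
    by (simp add: powr_minus)
  also have "\<dots> \<le> 2 powr (-\<mu>) * japanese_bracket \<xi> powr \<mu>"
    using * by (intro mult_left_mono) auto
  finally show ?thesis using False by simp
qed

section \<open>Interpolation\<close>

text \<open>By the mean value theorem, \<open>\<partial>\<^sub>e f\<close> varies by at most \<open>t B\<close> along the segment, so that
  \<open>f (z + t e) - f z\<close> differs from \<open>t \<partial>\<^sub>e f z\<close> by at most \<open>t\<^sup>2 B\<close>.\<close>

lemma partial_deriv_interpolation:
  fixes f :: "'a::euclidean_space \<Rightarrow> 'b::real_normed_vector"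
  assumes t: "t > 0"
    and d1: "\<And>s. 0 \<le> s \<Longrightarrow> s \<le> t \<Longrightarrow> f differentiable (at (z + s *\<^sub>R e))"
    and d2: "\<And>s. 0 \<le> s \<Longrightarrow> s \<le> t \<Longrightarrow> partial_deriv e f differentiable (at (z + s *\<^sub>R e))"
    and A: "\<And>s. 0 \<le> s \<Longrightarrow> s \<le> t \<Longrightarrow> norm (f (z + s *\<^sub>R e)) \<le> A"
    and B: "\<And>s. 0 \<le> s \<Longrightarrow> s \<le> t \<Longrightarrow> norm (partial_deriv e (partial_deriv e f) (z + s *\<^sub>R e)) \<le> B"
  shows "norm (partial_deriv e f z) \<le> 2 * A / t + t * B"
proof -
  have line: "((\<lambda>s. g (z + s *\<^sub>R e)) has_derivative (\<lambda>h. h *\<^sub>R partial_deriv e g (z + s *\<^sub>R e))) (at s within S)"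
    if "g differentiable (at (z + s *\<^sub>R e))" for g :: "'a \<Rightarrow> 'b" and s S
  proof -
    have "((\<lambda>s. g (z + s *\<^sub>R e)) has_derivative (\<lambda>h. frechet_derivative g (at (z + s *\<^sub>R e)) (h *\<^sub>R e))) (at s within S)"
      by (rule has_derivative_compose[where f = "\<lambda>s. z + s *\<^sub>R e" and g = g and f' = "\<lambda>h. h *\<^sub>R e",
             OF _ differentiable_imp_has_derivative[OF that]])
         (auto intro!: derivative_eq_intros)
    then show ?thesis
      using linear_frechet_derivative[OF that] by (simp add: partial_deriv_def linear_scale)
  qed
  have step1: "norm (partial_deriv e f (z + s *\<^sub>R e) - partial_deriv e f z) \<le> t * B" if "0 \<le> s" "s \<le> t" for s
  proof -
    have "norm (partial_deriv e f (z + s *\<^sub>R e) - partial_deriv e f (z + 0 *\<^sub>R e)) \<le> B * norm (s - 0)"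
    proof (rule differentiable_bound[where S = "{0..t}" and f = "\<lambda>s. partial_deriv e f (z + s *\<^sub>R e)"])
      fix x assume "x \<in> {0..t}"
      then have x: "0 \<le> x" "x \<le> t" by auto
      show "((\<lambda>s. partial_deriv e f (z + s *\<^sub>R e)) has_derivative
         (\<lambda>h. h *\<^sub>R partial_deriv e (partial_deriv e f) (z + x *\<^sub>R e))) (at x within {0..t})"
        by (rule line[OF d2[OF x]])
      show "onorm (\<lambda>h. h *\<^sub>R partial_deriv e (partial_deriv e f) (z + x *\<^sub>R e)) \<le> B"
        using B[OF x] by (intro onorm_le) (simp add: mult.commute[of B] mult_left_mono)
    qed (use that in auto)
    also have "\<dots> \<le> t * B"
      using that B[of 0] t order_trans[OF norm_ge_zero B[of 0]] by (simp add: mult.commute[of t] mult_left_mono)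
    finally show ?thesis by simp
  qed
  \<comment> \<open>Subtracting the linear part leaves a function whose derivative is the variation just bounded.\<close>
  let ?g = "\<lambda>s. f (z + s *\<^sub>R e) - s *\<^sub>R partial_deriv e f z"
  have "norm (?g t - ?g 0) \<le> (t * B) * norm (t - 0)"
  proof (rule differentiable_bound[where S = "{0..t}" and f = ?g])
    fix x assume "x \<in> {0..t}"
    then have x: "0 \<le> x" "x \<le> t" by auto
    show "(?g has_derivative (\<lambda>h. h *\<^sub>R partial_deriv e f (z + x *\<^sub>R e) - h *\<^sub>R partial_deriv e f z)) (at x within {0..t})"
      by (intro has_derivative_diff line[OF d1[OF x]]) (auto intro!: derivative_eq_intros)
    show "onorm (\<lambda>h. h *\<^sub>R partial_deriv e f (z + x *\<^sub>R e) - h *\<^sub>R partial_deriv e f z) \<le> t * B"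
      using step1[OF x] by (intro onorm_le) (simp add: mult.commute[of "t * B"] mult_left_mono flip: scaleR_diff_right)
  qed (use t in auto)
  then have "norm (f (z + t *\<^sub>R e) - f z - t *\<^sub>R partial_deriv e f z) \<le> t * B * t"
    using t by (simp add: algebra_simps)
  moreover have "norm (f (z + t *\<^sub>R e)) \<le> A" "norm (f z) \<le> A" using A[of t] A[of 0] t by auto
  moreover have "norm (t *\<^sub>R partial_deriv e f z) \<le>
      norm (f (z + t *\<^sub>R e) - f z - t *\<^sub>R partial_deriv e f z) + norm (f (z + t *\<^sub>R e)) + norm (f z)"
    using norm_triangle_ineq4[of "f (z + t *\<^sub>R e) - f z" "f (z + t *\<^sub>R e) - f z - t *\<^sub>R partial_deriv e f z"]
      norm_triangle_ineq4[of "f (z + t *\<^sub>R e)" "f z"] by simp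
  ultimately have "t * norm (partial_deriv e f z) \<le> 2 * A + t * B * t" using t by simp
  then show ?thesis using t by (simp add: field_simps)
qed

text \<open>The length \<open>d \<langle>\<xi>\<rangle>\<^sup>-\<^sup>\<sigma>\<close> trades decay between the two terms of the interpolation inequality: it
  costs \<open>\<sigma>\<close> orders on \<open>f\<close> and gains \<open>\<sigma>\<close> orders on the second derivative. Being at most \<open>d \<le> 1\<close>, it keeps
  the segment in \<open>K\<close> and lets Peetre's inequality absorb the change of the weight along it. The bound is
  linear in \<open>A\<close> and \<open>B\<close> with coefficients independent of \<open>\<xi>\<close>.\<close>

lemma weighted_interpolation:
  fixes f :: "(real^'n) \<times> (real^'p) \<Rightarrow> complex"
  assumes smooth: "smooth_on (\<Omega> \<times> UNIV) f" and e: "e \<in> Basis"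
    and d: "0 < d" "d \<le> 1" and ball: "cball x d \<subseteq> K" and K: "K \<subseteq> \<Omega>"
    and \<sigma>: "\<sigma> \<ge> 0" "\<sigma> \<ge> \<nu> + s"
    and A: "\<And>y \<eta>. y \<in> K \<Longrightarrow> norm (f (y, \<eta>)) \<le> A * japanese_bracket \<eta> powr (- s - \<sigma>)"
    and B: "\<And>y \<eta>. y \<in> K \<Longrightarrow> norm (partial_deriv e (partial_deriv e f) (y, \<eta>)) \<le> B * japanese_bracket \<eta> powr \<nu>"
  shows "norm (partial_deriv e f (x, \<xi>))
     \<le> (2 * 2 powr \<bar>s + \<sigma>\<bar> / d * A + d * 2 powr \<bar>\<nu>\<bar> * B) * japanese_bracket \<xi> powr (- s)"
proof -
  let ?w = "japanese_bracket \<xi>"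
  note w = japanese_bracket_ge_1[of \<xi>] japanese_bracket_pos[of \<xi>]
  define t where "t = d * ?w powr (- \<sigma>)"
  have t: "t > 0" using d w by (simp add: t_def)
  have "?w powr (- \<sigma>) \<le> ?w powr 0" using \<sigma> by (intro japanese_bracket_powr_mono) simp
  then have td: "t \<le> d" using d w by (simp add: t_def mult_left_le)
  have x: "x \<in> K" using ball d by auto
  have nonneg: "0 \<le> C" if "norm c \<le> C * japanese_bracket \<eta> powr \<mu>" for c :: complex and C \<eta> \<mu>
  proof -
    have "0 \<le> C * japanese_bracket \<eta> powr \<mu>" using that norm_ge_zero[of c] by linarith
    then show ?thesis using japanese_bracket_pos[of \<eta>] by (simp add: zero_le_mult_iff)
  qed
  have A0: "0 \<le> A" using nonneg[OF A[OF x]] .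
  have B0: "0 \<le> B" using nonneg[OF B[OF x]] .
  have seg: "fst ((x, \<xi>) + u *\<^sub>R e) \<in> K" "\<exists>v. norm v \<le> 1 \<and> snd ((x, \<xi>) + u *\<^sub>R e) = \<xi> + v"
    if "0 \<le> u" "u \<le> t" for u
  proof -
    have n: "norm (fst e) \<le> 1" "norm (snd e) \<le> 1"
      using e norm_fst_le[of "fst e" "snd e"] norm_snd_le[of "snd e" "fst e"] by auto
    have "norm (u *\<^sub>R fst e) \<le> d" "norm (u *\<^sub>R snd e) \<le> 1"
      using n mult_mono[of u d "norm (fst e)" 1] mult_mono[of u 1 "norm (snd e)" 1] that td d by auto
    then show "fst ((x, \<xi>) + u *\<^sub>R e) \<in> K" "\<exists>v. norm v \<le> 1 \<and> snd ((x, \<xi>) + u *\<^sub>R e) = \<xi> + v"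
      using ball by (auto simp: dist_norm subset_iff)
  qed
  have bd: "norm (g ((x, \<xi>) + u *\<^sub>R e)) \<le> C * (2 powr \<bar>\<mu>\<bar> * ?w powr \<mu>)"
    if g: "\<And>y \<eta>. y \<in> K \<Longrightarrow> norm (g (y, \<eta>)) \<le> C * japanese_bracket \<eta> powr \<mu>"
      and C: "0 \<le> C" and u: "0 \<le> u" "u \<le> t" for g :: "(real^'n) \<times> (real^'p) \<Rightarrow> complex" and C \<mu> u
  proof -
    obtain v where v: "norm v \<le> 1" "snd ((x, \<xi>) + u *\<^sub>R e) = \<xi> + v" using seg(2)[OF u] by blast
    have "norm (g ((x, \<xi>) + u *\<^sub>R e)) \<le> C * japanese_bracket (\<xi> + v) powr \<mu>"
      using g[OF seg(1)[OF u], of "snd ((x, \<xi>) + u *\<^sub>R e)"] v(2)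
      by (metis prod.collapse)
    also have "\<dots> \<le> C * (2 powr \<bar>\<mu>\<bar> * ?w powr \<mu>)"
      using peetre[OF v(1)] C by (intro mult_left_mono)
    finally show ?thesis .
  qed
  have inO: "(x, \<xi>) + u *\<^sub>R e \<in> \<Omega> \<times> UNIV" if "0 \<le> u" "u \<le> t" for u
    using seg(1)[OF that] K by (metis SigmaI UNIV_I prod.collapse subsetD)
  have "norm (partial_deriv e f (x, \<xi>)) \<le>
     2 * (A * (2 powr \<bar>- s - \<sigma>\<bar> * ?w powr (- s - \<sigma>))) / t + t * (B * (2 powr \<bar>\<nu>\<bar> * ?w powr \<nu>))"
  proof (rule partial_deriv_interpolation[OF t])
    fix u assume u: "0 \<le> u" "u \<le> t"
    show "f differentiable (at ((x, \<xi>) + u *\<^sub>R e))"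
      using smooth_on_imp_differentiable[OF smooth inO[OF u]] .
    show "partial_deriv e f differentiable (at ((x, \<xi>) + u *\<^sub>R e))"
      using smooth_on_imp_differentiable[OF smooth_on_partial_deriv[OF smooth e] inO[OF u]] .
  qed (use bd[OF A A0] bd[OF B B0] in auto)
  also have "\<bar>- s - \<sigma>\<bar> = \<bar>s + \<sigma>\<bar>" by simp
  also have "2 * (A * (2 powr \<bar>s + \<sigma>\<bar> * ?w powr (- s - \<sigma>))) / t = 2 * 2 powr \<bar>s + \<sigma>\<bar> / d * A * ?w powr (- s)"
    using w d by (simp add: t_def powr_diff powr_minus field_simps)
  also have "t * (B * (2 powr \<bar>\<nu>\<bar> * ?w powr \<nu>)) = d * 2 powr \<bar>\<nu>\<bar> * B * ?w powr (\<nu> - \<sigma>)"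
    using w by (simp add: t_def powr_diff powr_minus field_simps)
  also have "d * 2 powr \<bar>\<nu>\<bar> * B * ?w powr (\<nu> - \<sigma>) \<le> d * 2 powr \<bar>\<nu>\<bar> * B * ?w powr (- s)"
    using \<sigma> d B0 by (intro mult_left_mono japanese_bracket_powr_mono) auto
  finally show ?thesis by (simp add: algebra_simps)
qed

section \<open>Classes of nets\<close>

lemma eventually_at_right_0_unit_interval: "eventually (\<lambda>\<epsilon>::real. \<epsilon> \<in> {0<..1}) (at_right 0)"
  by (rule eventually_mono[OF eventually_at_right_real[of 0 1]]) auto

text \<open>\<open>N\<close> is meant to be \<open>moderate_net\<close> or \<open>slow_scale_type\<close>. Absolute values in \<open>abs_plus\<close> make the
  sum dominate both summands without cancellation, so that together with \<open>dominated\<close> it yields all linear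
  combinations.\<close>

locale net_class =
  fixes N :: "(real \<Rightarrow> real) \<Rightarrow> bool"
  assumes zero: "N (\<lambda>_. 0)"
    and dominated: "N C \<Longrightarrow> D \<in> O[at_right 0](C) \<Longrightarrow> N D"
    and abs_plus: "N C \<Longrightarrow> N D \<Longrightarrow> N (\<lambda>\<epsilon>. \<bar>C \<epsilon>\<bar> + \<bar>D \<epsilon>\<bar>)"
begin

lemma le_imp_net:
  assumes "N C" "\<And>\<epsilon>. \<epsilon> \<in> {0<..1} \<Longrightarrow> \<bar>D \<epsilon>\<bar> \<le> \<bar>C \<epsilon>\<bar>"
  shows "N D"
proof (rule dominated[OF assms(1)], rule bigoI[where c = 1])
  show "\<forall>\<^sub>F \<epsilon> in at_right 0. norm (D \<epsilon>) \<le> 1 * norm (C \<epsilon>)"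
    using eventually_at_right_0_unit_interval by eventually_elim (use assms(2) in auto)
qed

lemma linear_combination:
  assumes "N C" "N D"
  shows "N (\<lambda>\<epsilon>. c * C \<epsilon> + d * D \<epsilon>)"
proof (rule dominated[OF abs_plus[OF assms]], rule bigoI[where c = "\<bar>c\<bar> + \<bar>d\<bar>"], rule always_eventually, rule allI)
  fix \<epsilon>
  have "\<bar>c * C \<epsilon> + d * D \<epsilon>\<bar> \<le> \<bar>c\<bar> * \<bar>C \<epsilon>\<bar> + \<bar>d\<bar> * \<bar>D \<epsilon>\<bar>"
    by (metis abs_mult abs_triangle_ineq)
  also have "\<dots> \<le> (\<bar>c\<bar> + \<bar>d\<bar>) * (\<bar>C \<epsilon>\<bar> + \<bar>D \<epsilon>\<bar>)"
    by (simp add: distrib_left distrib_right)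
  finally show "norm (c * C \<epsilon> + d * D \<epsilon>) \<le> (\<bar>c\<bar> + \<bar>d\<bar>) * norm (\<bar>C \<epsilon>\<bar> + \<bar>D \<epsilon>\<bar>)" by simp
qed

lemma abs_net: "N C \<Longrightarrow> N (\<lambda>\<epsilon>. \<bar>C \<epsilon>\<bar>)"
  by (rule le_imp_net) auto

lemma sum_net:
  assumes "finite I" "\<And>i. i \<in> I \<Longrightarrow> N (C i)"
  shows "N (\<lambda>\<epsilon>. \<Sum>i\<in>I. C i \<epsilon>)"
  using assms
proof (induction I rule: finite_induct)
  case (insert i I)
  then show ?case using linear_combination[of "C i" "\<lambda>\<epsilon>. \<Sum>i\<in>I. C i \<epsilon>" 1 1] by simp
qed (simp add: zero)

definition weight_bounded ::
  "'x set \<Rightarrow> (real \<Rightarrow> 'x \<times> 'y::real_normed_vector \<Rightarrow> 'z::real_normed_vector) \<Rightarrow> real \<Rightarrow> bool" where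
  "weight_bounded K u \<mu> \<longleftrightarrow> (\<exists>C. N C \<and> (\<forall>x\<in>K. \<forall>\<xi>. \<forall>\<epsilon>\<in>{0<..1}.
     norm (u \<epsilon> (x, \<xi>)) \<le> C \<epsilon> * japanese_bracket \<xi> powr \<mu>))"

lemma weight_bounded_mono:
  assumes "weight_bounded K u \<mu>" "\<mu> \<le> \<nu>"
  shows "weight_bounded K u \<nu>"
proof -
  obtain C where C: "N C" "\<And>x \<xi> \<epsilon>. x \<in> K \<Longrightarrow> \<epsilon> \<in> {0<..1} \<Longrightarrow>
      norm (u \<epsilon> (x, \<xi>)) \<le> C \<epsilon> * japanese_bracket \<xi> powr \<mu>"
    using assms(1) unfolding weight_bounded_def by blast
  have "norm (u \<epsilon> (x, \<xi>)) \<le> \<bar>C \<epsilon>\<bar> * japanese_bracket \<xi> powr \<nu>" if "x \<in> K" "\<epsilon> \<in> {0<..1}" for x \<xi> \<epsilon>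
  proof -
    have "C \<epsilon> * japanese_bracket \<xi> powr \<mu> \<le> \<bar>C \<epsilon>\<bar> * japanese_bracket \<xi> powr \<nu>"
      using japanese_bracket_powr_mono[OF assms(2)] by (intro mult_mono) auto
    then show ?thesis using C(2)[OF that, of \<xi>] by linarith
  qed
  then show ?thesis using abs_net[OF C(1)] unfolding weight_bounded_def by blast
qed

lemma weight_bounded_add_scaled:
  assumes "weight_bounded K u \<mu>" "weight_bounded K v \<mu>"
    and eq: "\<And>x \<xi> \<epsilon>. x \<in> K \<Longrightarrow> \<epsilon> \<in> {0<..1} \<Longrightarrow> w \<epsilon> (x, \<xi>) = u \<epsilon> (x, \<xi>) + c *\<^sub>R v \<epsilon> (x, \<xi>)"
  shows "weight_bounded K w \<mu>"
proof -
  obtain C where C: "N C" "\<And>x \<xi> \<epsilon>. x \<in> K \<Longrightarrow> \<epsilon> \<in> {0<..1} \<Longrightarrow>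
      norm (u \<epsilon> (x, \<xi>)) \<le> C \<epsilon> * japanese_bracket \<xi> powr \<mu>"
    using assms(1) unfolding weight_bounded_def by blast
  obtain D where D: "N D" "\<And>x \<xi> \<epsilon>. x \<in> K \<Longrightarrow> \<epsilon> \<in> {0<..1} \<Longrightarrow>
      norm (v \<epsilon> (x, \<xi>)) \<le> D \<epsilon> * japanese_bracket \<xi> powr \<mu>"
    using assms(2) unfolding weight_bounded_def by blast
  have "norm (w \<epsilon> (x, \<xi>)) \<le> (1 * C \<epsilon> + \<bar>c\<bar> * D \<epsilon>) * japanese_bracket \<xi> powr \<mu>"
    if "x \<in> K" "\<epsilon> \<in> {0<..1}" for x \<xi> \<epsilon>
  proof -
    have "norm (w \<epsilon> (x, \<xi>)) \<le> norm (u \<epsilon> (x, \<xi>)) + \<bar>c\<bar> * norm (v \<epsilon> (x, \<xi>))"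
      using norm_triangle_ineq[of "u \<epsilon> (x, \<xi>)" "c *\<^sub>R v \<epsilon> (x, \<xi>)"] eq[OF that] by simp
    moreover have "\<bar>c\<bar> * norm (v \<epsilon> (x, \<xi>)) \<le> \<bar>c\<bar> * (D \<epsilon> * japanese_bracket \<xi> powr \<mu>)"
      using D(2)[OF that] by (intro mult_left_mono) auto
    ultimately show ?thesis using C(2)[OF that, of \<xi>] by (simp add: distrib_right mult.assoc)
  qed
  then show ?thesis using linear_combination[OF C(1) D(1), of 1 "\<bar>c\<bar>"] unfolding weight_bounded_def by blast
qed

definition symbol_nets ::
  "real \<Rightarrow> real \<Rightarrow> (real^'n) set \<Rightarrow> real \<Rightarrow> (real \<Rightarrow> (real^'n) \<times> (real^'p) \<Rightarrow> complex) set" where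
  "symbol_nets \<rho> \<delta> \<Omega> m =
     {u. (\<forall>\<epsilon>\<in>{0<..1}. u \<epsilon> \<in> symbol_space \<rho> \<delta> \<Omega> m) \<and>
         (\<forall>i\<in>symbol_index \<Omega>. N (\<lambda>\<epsilon>. symbol_seminorm \<rho> \<delta> m i (u \<epsilon>)))}"

lemma symbol_nets_smooth:
  "u \<in> symbol_nets \<rho> \<delta> \<Omega> m \<Longrightarrow> \<epsilon> \<in> {0<..1} \<Longrightarrow> smooth_on (\<Omega> \<times> UNIV) (u \<epsilon>)"
  by (auto simp: symbol_nets_def symbol_space_def)

lemma symbol_nets_weight_bounded:
  fixes u :: "real \<Rightarrow> (real^'n) \<times> (real^'p) \<Rightarrow> complex" and \<rho> \<delta> m :: real
  assumes u: "u \<in> symbol_nets \<rho> \<delta> \<Omega> m" and K: "compact K" "K \<subseteq> \<Omega>"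
  shows "weight_bounded K (\<lambda>\<epsilon>. sym_deriv \<alpha> \<beta> (u \<epsilon>)) (m - \<rho> * mi_order \<alpha> + \<delta> * mi_order \<beta>)"
proof -
  let ?j = "mi_order \<alpha> + mi_order \<beta>"
  let ?e = "- m + \<rho> * mi_order \<alpha> - \<delta> * mi_order \<beta>"
  have i: "(K, ?j) \<in> symbol_index \<Omega>" using K by (simp add: symbol_index_def)
  have "norm (sym_deriv \<alpha> \<beta> (u \<epsilon>) (x, \<xi>))
      \<le> symbol_seminorm \<rho> \<delta> m (K, ?j) (u \<epsilon>) * japanese_bracket \<xi> powr (m - \<rho> * mi_order \<alpha> + \<delta> * mi_order \<beta>)"
    if x: "x \<in> K" and \<epsilon>: "\<epsilon> \<in> {0<..1}" for x \<xi> \<epsilon>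
  proof -
    have fin: "symbol_esup \<rho> \<delta> m K ?j (u \<epsilon>) < \<infinity>"
      using u \<epsilon> i unfolding symbol_nets_def symbol_space_def by fastforce
    have "ennreal (norm (sym_deriv \<alpha> \<beta> (u \<epsilon>) (x, \<xi>)) * japanese_bracket \<xi> powr ?e)
        \<le> symbol_esup \<rho> \<delta> m K ?j (u \<epsilon>)"
      unfolding symbol_esup_def
      by (rule SUP_upper2[of "(x, \<xi>)"], use x in simp, simp, rule SUP_upper2[of "(\<alpha>, \<beta>)"]) auto
    also have "\<dots> = ennreal (symbol_seminorm \<rho> \<delta> m (K, ?j) (u \<epsilon>))"
      using fin by (simp add: symbol_seminorm_def)
    finally have "norm (sym_deriv \<alpha> \<beta> (u \<epsilon>) (x, \<xi>)) * japanese_bracket \<xi> powr ?e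
        \<le> symbol_seminorm \<rho> \<delta> m (K, ?j) (u \<epsilon>)"
      by (subst (asm) ennreal_le_iff) (simp_all add: symbol_seminorm_def)
    then have "norm (sym_deriv \<alpha> \<beta> (u \<epsilon>) (x, \<xi>)) * japanese_bracket \<xi> powr ?e * japanese_bracket \<xi> powr (- ?e)
        \<le> symbol_seminorm \<rho> \<delta> m (K, ?j) (u \<epsilon>) * japanese_bracket \<xi> powr (- ?e)"
      by (rule mult_right_mono) simp
    moreover have "japanese_bracket \<xi> powr ?e * japanese_bracket \<xi> powr (- ?e) = 1"
      using japanese_bracket_pos[of \<xi>] by (simp flip: powr_add)
    ultimately show ?thesis by (simp add: mult.assoc algebra_simps)
  qed
  moreover have "N (\<lambda>\<epsilon>. symbol_seminorm \<rho> \<delta> m (K, ?j) (u \<epsilon>))"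
    using u i by (simp add: symbol_nets_def)
  ultimately show ?thesis unfolding weight_bounded_def by blast
qed

text \<open>A seminorm is a supremum over finitely many multi-indices, so the sum of the constants for the single
  derivatives dominates it; in particular it is finite for every \<open>\<epsilon>\<close>.\<close>

lemma symbol_netsI:
  fixes u :: "real \<Rightarrow> (real^'n) \<times> (real^'p) \<Rightarrow> complex" and \<rho> \<delta> m :: real
  assumes smooth: "\<And>\<epsilon>. \<epsilon> \<in> {0<..1} \<Longrightarrow> smooth_on (\<Omega> \<times> UNIV) (u \<epsilon>)"
    and bounds: "\<And>K \<alpha> \<beta>. compact K \<Longrightarrow> K \<subseteq> \<Omega> \<Longrightarrow>
      weight_bounded K (\<lambda>\<epsilon>. sym_deriv \<alpha> \<beta> (u \<epsilon>)) (m - \<rho> * mi_order \<alpha> + \<delta> * mi_order \<beta>)"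
  shows "u \<in> symbol_nets \<rho> \<delta> \<Omega> m"
proof -
  have main: "\<exists>D. N D \<and> (\<forall>\<epsilon>\<in>{0<..1}. 0 \<le> D \<epsilon> \<and> symbol_esup \<rho> \<delta> m K j (u \<epsilon>) \<le> ennreal (D \<epsilon>))"
    if K: "compact K" "K \<subseteq> \<Omega>" for K j
  proof -
    obtain C where C: "\<And>\<alpha> \<beta>. N (C \<alpha> \<beta>)" "\<And>\<alpha> \<beta> x \<xi> \<epsilon>. x \<in> K \<Longrightarrow> \<epsilon> \<in> {0<..1} \<Longrightarrow>
        norm (sym_deriv \<alpha> \<beta> (u \<epsilon>) (x, \<xi>))
          \<le> C \<alpha> \<beta> \<epsilon> * japanese_bracket \<xi> powr (m - \<rho> * mi_order \<alpha> + \<delta> * mi_order \<beta>)"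
      using bounds[OF K] unfolding weight_bounded_def by metis
    let ?F = "{(\<alpha> :: 'p \<Rightarrow> nat, \<beta> :: 'n \<Rightarrow> nat). mi_order \<alpha> + mi_order \<beta> \<le> j}"
    define D where "D \<epsilon> = (\<Sum>(\<alpha>, \<beta>)\<in>?F. \<bar>C \<alpha> \<beta> \<epsilon>\<bar>)" for \<epsilon>
    have "N (\<lambda>\<epsilon>. \<Sum>i\<in>?F. \<bar>C (fst i) (snd i) \<epsilon>\<bar>)"
      using abs_net[OF C(1)] by (intro sum_net finite_mi_order_le)
    then have ND: "N D" by (simp add: D_def[abs_def] case_prod_beta)
    have "symbol_esup \<rho> \<delta> m K j (u \<epsilon>) \<le> ennreal (D \<epsilon>)" if \<epsilon>: "\<epsilon> \<in> {0<..1}" for \<epsilon>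
    proof -
      have "norm (sym_deriv \<alpha> \<beta> (u \<epsilon>) (x, \<xi>)) *
          japanese_bracket \<xi> powr (- m + \<rho> * real (mi_order \<alpha>) - \<delta> * real (mi_order \<beta>)) \<le> D \<epsilon>"
        if x: "x \<in> K" and F: "(\<alpha>, \<beta>) \<in> ?F" for x \<xi> \<alpha> \<beta>
      proof -
        let ?e = "m - \<rho> * mi_order \<alpha> + \<delta> * mi_order \<beta>"
        have "norm (sym_deriv \<alpha> \<beta> (u \<epsilon>) (x, \<xi>)) * japanese_bracket \<xi> powr (- ?e)
            \<le> C \<alpha> \<beta> \<epsilon> * japanese_bracket \<xi> powr ?e * japanese_bracket \<xi> powr (- ?e)"
          by (rule mult_right_mono[OF C(2)[OF x \<epsilon>]]) simp
        also have "\<dots> = C \<alpha> \<beta> \<epsilon>"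
          using japanese_bracket_pos[of \<xi>] by (simp add: mult.assoc flip: powr_add)
        also have "\<dots> \<le> \<bar>C \<alpha> \<beta> \<epsilon>\<bar>" by simp
        also have "\<dots> \<le> D \<epsilon>"
          using member_le_sum[OF F, of "\<lambda>(\<alpha>, \<beta>). \<bar>C \<alpha> \<beta> \<epsilon>\<bar>"] finite_mi_order_le
          unfolding D_def by fastforce
        finally show ?thesis by (simp add: algebra_simps)
      qed
      then show ?thesis unfolding symbol_esup_def
        by (intro SUP_least) (auto intro!: SUP_least ennreal_leI)
    qed
    moreover have "0 \<le> D \<epsilon>" for \<epsilon> by (auto simp: D_def intro!: sum_nonneg)
    ultimately show ?thesis using ND by blast
  qed
  have "u \<epsilon> \<in> symbol_space \<rho> \<delta> \<Omega> m" if \<epsilon>: "\<epsilon> \<in> {0<..1}" for \<epsilon>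
  proof -
    have "symbol_esup \<rho> \<delta> m K j (u \<epsilon>) < \<infinity>" if "compact K" "K \<subseteq> \<Omega>" for K j
      using main[OF that, of j] \<epsilon> by (metis ennreal_less_top infinity_ennreal_def le_less_trans)
    then show ?thesis using smooth[OF \<epsilon>] by (auto simp: symbol_space_def symbol_index_def)
  qed
  moreover have "N (\<lambda>\<epsilon>. symbol_seminorm \<rho> \<delta> m (K, j) (u \<epsilon>))" if K: "compact K" "K \<subseteq> \<Omega>" for K j
  proof -
    obtain D where D: "N D" "\<And>\<epsilon>. \<epsilon> \<in> {0<..1} \<Longrightarrow> 0 \<le> D \<epsilon>"
      "\<And>\<epsilon>. \<epsilon> \<in> {0<..1} \<Longrightarrow> symbol_esup \<rho> \<delta> m K j (u \<epsilon>) \<le> ennreal (D \<epsilon>)"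
      using main[OF K, of j] by blast
    show ?thesis
      using D(2,3) by (intro le_imp_net[OF D(1)]) (simp add: symbol_seminorm_def enn2real_leI)
  qed
  ultimately show ?thesis by (auto simp: symbol_nets_def symbol_index_def)
qed

section \<open>Decay of derivatives\<close>

text \<open>Induction on the order of differentiation, peeling off the outermost derivative. The hypothesis
  \<open>uniform\<close> fixes the growth \<open>\<nu>\<close> of the next higher derivative before \<open>R\<close> is chosen; this
  breaks the circularity, since the decay demanded of the lower derivative depends on \<open>\<nu>\<close>.\<close>

lemma weight_bounded_derivatives_decay:
  fixes b :: "nat \<Rightarrow> real \<Rightarrow> (real^'n) \<times> (real^'p) \<Rightarrow> complex"
  assumes \<Omega>: "open \<Omega>"
    and smooth: "\<And>R \<epsilon>. \<epsilon> \<in> {0<..1} \<Longrightarrow> smooth_on (\<Omega> \<times> UNIV) (b R \<epsilon>)"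
    and uniform: "\<And>K \<alpha> \<beta>. compact K \<Longrightarrow> K \<subseteq> \<Omega> \<Longrightarrow>
      \<exists>\<nu>. \<forall>R. weight_bounded K (\<lambda>\<epsilon>. sym_deriv \<alpha> \<beta> (b R \<epsilon>)) \<nu>"
    and decay: "\<And>K s. compact K \<Longrightarrow> K \<subseteq> \<Omega> \<Longrightarrow> \<exists>R\<ge>r. weight_bounded K (b R) (- s)"
    and K: "compact K" "K \<subseteq> \<Omega>"
  shows "\<exists>R\<ge>r. weight_bounded K (\<lambda>\<epsilon>. sym_deriv \<alpha> \<beta> (b R \<epsilon>)) (- s)"
  using K
proof (induction "length (symbol_directions \<alpha> \<beta>)" arbitrary: \<alpha> \<beta> K s)
  case 0
  then show ?case using decay by (simp add: sym_deriv_eq_iterated_deriv)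
next
  case (Suc k)
  then have "symbol_directions \<alpha> \<beta> \<noteq> []" by auto
  then obtain e \<alpha>\<^sub>1 \<beta>\<^sub>1 \<alpha>\<^sub>2 \<beta>\<^sub>2 where dirs:
    "symbol_directions \<alpha> \<beta> = e # symbol_directions \<alpha>\<^sub>1 \<beta>\<^sub>1"
    "symbol_directions \<alpha>\<^sub>2 \<beta>\<^sub>2 = e # symbol_directions \<alpha> \<beta>"
    by (rule symbol_directions_peel)
  have e: "e \<in> Basis" using symbol_directions_subset_Basis[of \<alpha> \<beta>] dirs(1) by simp
  obtain d\<^sub>0 where d0: "d\<^sub>0 > 0" "(\<Union>x\<in>K. cball x d\<^sub>0) \<subseteq> \<Omega>"
    using compact_subset_open_imp_cball_epsilon_subset[OF Suc.prems(1) \<Omega> Suc.prems(2)] .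
  define d where "d = min d\<^sub>0 1"
  have d: "0 < d" "d \<le> 1" using d0(1) by (auto simp: d_def)
  define K' where "K' = (\<Union>x\<in>K. cball x d)"
  have K': "compact K'" "K' \<subseteq> \<Omega>"
    using compact_minkowski_sum_cball[OF Suc.prems(1)] d0(2) by (fastforce simp: K'_def d_def)+
  obtain \<nu> where \<nu>: "\<And>R. weight_bounded K' (\<lambda>\<epsilon>. sym_deriv \<alpha>\<^sub>2 \<beta>\<^sub>2 (b R \<epsilon>)) \<nu>"
    using uniform[OF K'] by blast
  define \<sigma> where "\<sigma> = max 0 (\<nu> + s)"
  obtain R where R: "R \<ge> r" "weight_bounded K' (\<lambda>\<epsilon>. sym_deriv \<alpha>\<^sub>1 \<beta>\<^sub>1 (b R \<epsilon>)) (- (s + \<sigma>))"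
    using Suc.hyps(1)[OF _ K', of \<alpha>\<^sub>1 \<beta>\<^sub>1 "s + \<sigma>"] Suc.hyps(2) dirs(1) by auto
  obtain A where A: "N A" "\<And>x \<xi> \<epsilon>. x \<in> K' \<Longrightarrow> \<epsilon> \<in> {0<..1} \<Longrightarrow>
      norm (sym_deriv \<alpha>\<^sub>1 \<beta>\<^sub>1 (b R \<epsilon>) (x, \<xi>)) \<le> A \<epsilon> * japanese_bracket \<xi> powr (- s - \<sigma>)"
    using R(2) unfolding weight_bounded_def by auto
  obtain B where B: "N B" "\<And>x \<xi> \<epsilon>. x \<in> K' \<Longrightarrow> \<epsilon> \<in> {0<..1} \<Longrightarrow>
      norm (sym_deriv \<alpha>\<^sub>2 \<beta>\<^sub>2 (b R \<epsilon>) (x, \<xi>)) \<le> B \<epsilon> * japanese_bracket \<xi> powr \<nu>"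
    using \<nu>[of R] unfolding weight_bounded_def by auto
  have step: "partial_deriv e (sym_deriv \<alpha>\<^sub>1 \<beta>\<^sub>1 f) = sym_deriv \<alpha> \<beta> f"
    "partial_deriv e (partial_deriv e (sym_deriv \<alpha>\<^sub>1 \<beta>\<^sub>1 f)) = sym_deriv \<alpha>\<^sub>2 \<beta>\<^sub>2 f" for f
    by (simp_all add: sym_deriv_eq_iterated_deriv dirs)
  have "norm (sym_deriv \<alpha> \<beta> (b R \<epsilon>) (x, \<xi>))
      \<le> (2 * 2 powr \<bar>s + \<sigma>\<bar> / d * A \<epsilon> + d * 2 powr \<bar>\<nu>\<bar> * B \<epsilon>) * japanese_bracket \<xi> powr (- s)"
    if x: "x \<in> K" and \<epsilon>: "\<epsilon> \<in> {0<..1}" for x \<xi> \<epsilon>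
  proof -
    have sm: "smooth_on (\<Omega> \<times> UNIV) (sym_deriv \<alpha>\<^sub>1 \<beta>\<^sub>1 (b R \<epsilon>))"
      using smooth_on_iterated_deriv[OF smooth[OF \<epsilon>] symbol_directions_subset_Basis]
      by (simp add: sym_deriv_eq_iterated_deriv)
    have "norm (partial_deriv e (sym_deriv \<alpha>\<^sub>1 \<beta>\<^sub>1 (b R \<epsilon>)) (x, \<xi>))
        \<le> (2 * 2 powr \<bar>s + \<sigma>\<bar> / d * A \<epsilon> + d * 2 powr \<bar>\<nu>\<bar> * B \<epsilon>) * japanese_bracket \<xi> powr (- s)"
    proof (rule weighted_interpolation[OF sm e d _ K'(2)])
      show "norm (partial_deriv e (partial_deriv e (sym_deriv \<alpha>\<^sub>1 \<beta>\<^sub>1 (b R \<epsilon>))) (y, \<eta>))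
          \<le> B \<epsilon> * japanese_bracket \<eta> powr \<nu>" if "y \<in> K'" for y \<eta>
        unfolding step(2) using B(2)[OF that \<epsilon>] .
    qed (use A(2)[OF _ \<epsilon>] x in \<open>auto simp: K'_def \<sigma>_def\<close>)
    then show ?thesis unfolding step(1) .
  qed
  then show ?case
    using linear_combination[OF A(1) B(1)] R(1) unfolding weight_bounded_def by blast
qed

lemma asymptotic_expansion:
  fixes "as" :: "nat \<Rightarrow> real \<Rightarrow> (real^'n) \<times> (real^'p) \<Rightarrow> complex"
  assumes \<Omega>: "open \<Omega>" and ms: "decseq ms"
    and as: "\<And>j. as j \<in> symbol_nets \<rho> \<delta> \<Omega> (ms j)"
    and a: "\<And>\<epsilon>. \<epsilon> \<in> {0<..1} \<Longrightarrow> smooth_on (\<Omega> \<times> UNIV) (a \<epsilon>)"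
    and a_bounds: "\<And>K \<alpha> \<beta>. compact K \<Longrightarrow> K \<subseteq> \<Omega> \<Longrightarrow>
      \<exists>\<mu>. weight_bounded K (\<lambda>\<epsilon>. sym_deriv \<alpha> \<beta> (a \<epsilon>)) \<mu>"
    and rem: "\<And>K. compact K \<Longrightarrow> K \<subseteq> \<Omega> \<Longrightarrow> \<exists>\<mu>. filterlim \<mu> at_bot sequentially \<and>
      (\<forall>r\<ge>1. weight_bounded K (\<lambda>\<epsilon> z. a \<epsilon> z - (\<Sum>j<r. as j \<epsilon> z)) (\<mu> r))"
  shows "(\<lambda>\<epsilon> z. a \<epsilon> z - (\<Sum>j<r. as j \<epsilon> z)) \<in> symbol_nets \<rho> \<delta> \<Omega> (ms r)"
proof -
  define b where "b R \<epsilon> z = a \<epsilon> z - (\<Sum>j<R. as j \<epsilon> z)" for R \<epsilon> z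
  have U: "open (\<Omega> \<times> (UNIV :: (real^'p) set))" using \<Omega> by (simp add: open_Times)
  have b_0: "b 0 = a" by (simp add: b_def fun_eq_iff)
  have b_Suc: "b (Suc R) \<epsilon> = (\<lambda>z. b R \<epsilon> z + (-1) *\<^sub>R as R \<epsilon> z)" for R \<epsilon>
    by (simp add: b_def fun_eq_iff)
  have smooth: "smooth_on (\<Omega> \<times> UNIV) (b R \<epsilon>)" if "\<epsilon> \<in> {0<..1}" for R \<epsilon>
  proof (induction R)
    case (Suc R)
    show ?case unfolding b_Suc
      by (rule smooth_on_add_scaled[OF U Suc symbol_nets_smooth[OF as that]])
  qed (simp add: b_0 a[OF that])
  have deriv_Suc: "sym_deriv \<alpha> \<beta> (b (Suc R) \<epsilon>) (x, \<xi>) =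
      sym_deriv \<alpha> \<beta> (b R \<epsilon>) (x, \<xi>) + (-1) *\<^sub>R sym_deriv \<alpha> \<beta> (as R \<epsilon>) (x, \<xi>)"
    if "x \<in> \<Omega>" "\<epsilon> \<in> {0<..1}" for \<alpha> \<beta> R \<epsilon> x \<xi>
    unfolding b_Suc sym_deriv_eq_iterated_deriv
    by (rule iterated_deriv_add_scaled[OF U smooth[OF that(2)] symbol_nets_smooth[OF as that(2)]
          symbol_directions_subset_Basis]) (use that in simp)
  have as_bounds: "weight_bounded K (\<lambda>\<epsilon>. sym_deriv \<alpha> \<beta> (as j \<epsilon>)) (ms i - \<rho> * mi_order \<alpha> + \<delta> * mi_order \<beta>)"
    if "compact K" "K \<subseteq> \<Omega>" "i \<le> j" for K \<alpha> \<beta> i j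
    using weight_bounded_mono[OF symbol_nets_weight_bounded[OF as that(1,2)]] decseqD[OF ms that(3)] by simp
  have uniform: "\<exists>\<nu>. \<forall>R. weight_bounded K (\<lambda>\<epsilon>. sym_deriv \<alpha> \<beta> (b R \<epsilon>)) \<nu>"
    if K: "compact K" "K \<subseteq> \<Omega>" for K \<alpha> \<beta>
  proof -
    obtain \<mu> where \<mu>: "weight_bounded K (\<lambda>\<epsilon>. sym_deriv \<alpha> \<beta> (a \<epsilon>)) \<mu>" using a_bounds[OF K] by blast
    define \<nu> where "\<nu> = max \<mu> (ms 0 - \<rho> * mi_order \<alpha> + \<delta> * mi_order \<beta>)"
    have "weight_bounded K (\<lambda>\<epsilon>. sym_deriv \<alpha> \<beta> (b R \<epsilon>)) \<nu>" for R
    proof (induction R)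
      case 0
      show ?case unfolding b_0 by (rule weight_bounded_mono[OF \<mu>]) (simp add: \<nu>_def)
    next
      case (Suc R)
      show ?case
      proof (rule weight_bounded_add_scaled[OF Suc])
        show "weight_bounded K (\<lambda>\<epsilon>. sym_deriv \<alpha> \<beta> (as R \<epsilon>)) \<nu>"
          by (rule weight_bounded_mono[OF as_bounds[OF K le0]]) (simp add: \<nu>_def)
      qed (use deriv_Suc K in blast)
    qed
    then show ?thesis by blast
  qed
  have decay: "\<exists>R\<ge>r. weight_bounded K (b R) (- s)" if K: "compact K" "K \<subseteq> \<Omega>" for K s
  proof -
    obtain \<mu> where \<mu>: "filterlim \<mu> at_bot sequentially" "\<And>r. r \<ge> 1 \<Longrightarrow> weight_bounded K (b r) (\<mu> r)"
      using rem[OF K] unfolding b_def by blast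
    have "eventually (\<lambda>R. \<mu> R \<le> - s \<and> R \<ge> max r 1) sequentially"
      using \<mu>(1) eventually_ge_at_top[of "max r 1"] by (auto simp: filterlim_at_bot intro: eventually_conj)
    then obtain R where "\<mu> R \<le> - s" "R \<ge> max r 1" using eventually_happens by force
    then show ?thesis using weight_bounded_mono[OF \<mu>(2)[of R]] by auto
  qed
  have "b r \<in> symbol_nets \<rho> \<delta> \<Omega> (ms r)"
  proof (rule symbol_netsI)
    fix K and \<alpha> :: "'p \<Rightarrow> nat" and \<beta> :: "'n \<Rightarrow> nat"
    assume K: "compact K" "K \<subseteq> \<Omega>"
    define \<tau> where "\<tau> = ms r - \<rho> * mi_order \<alpha> + \<delta> * mi_order \<beta>"
    obtain R where R: "R \<ge> r" "weight_bounded K (\<lambda>\<epsilon>. sym_deriv \<alpha> \<beta> (b R \<epsilon>)) \<tau>"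
      using weight_bounded_derivatives_decay[OF \<Omega> smooth uniform decay K, of \<alpha> \<beta> "- \<tau>"] by auto
    \<comment> \<open>Descend from \<open>R\<close> to \<open>r\<close>, adding back the terms \<open>as i\<close>, whose order is at most \<open>ms r\<close>.\<close>
    from R have "weight_bounded K (\<lambda>\<epsilon>. sym_deriv \<alpha> \<beta> (b r \<epsilon>)) \<tau>"
    proof (induction rule: inc_induct)
      case (step i)
      show ?case
      proof (rule weight_bounded_add_scaled[OF step.IH])
        show "weight_bounded K (\<lambda>\<epsilon>. sym_deriv \<alpha> \<beta> (as i \<epsilon>)) \<tau>"
          unfolding \<tau>_def by (rule as_bounds[OF K step.hyps(1)])
        show "sym_deriv \<alpha> \<beta> (b i \<epsilon>) (x, \<xi>)
            = sym_deriv \<alpha> \<beta> (b (Suc i) \<epsilon>) (x, \<xi>) + 1 *\<^sub>R sym_deriv \<alpha> \<beta> (as i \<epsilon>) (x, \<xi>)"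
          if "x \<in> K" "\<epsilon> \<in> {0<..1}" for x \<xi> \<epsilon>
          using deriv_Suc[of x \<epsilon> \<alpha> \<beta> i \<xi>] that K(2) by auto
      qed (use step in simp)
    qed simp
    then show "weight_bounded K (\<lambda>\<epsilon>. sym_deriv \<alpha> \<beta> (b r \<epsilon>)) (ms r - \<rho> * mi_order \<alpha> + \<delta> * mi_order \<beta>)"
      by (simp add: \<tau>_def)
  qed (use smooth in blast)
  then show ?thesis unfolding b_def .
qed

end

section \<open>Moderate nets and nets of slow scale type\<close>

lemma moderate_net_class: "net_class moderate_net"
proof
  show "moderate_net (\<lambda>_. 0)" by (simp add: moderate_net_def)
  show "moderate_net D" if "moderate_net C" "D \<in> O[at_right 0](C)" for C D
    using that landau_o.big_trans unfolding moderate_net_def by blast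
  show "moderate_net (\<lambda>\<epsilon>. \<bar>C \<epsilon>\<bar> + \<bar>D \<epsilon>\<bar>)" if CD: "moderate_net C" "moderate_net D" for C D
  proof -
    have mono: "(\<lambda>\<epsilon>. 1 / \<epsilon> ^ i) \<in> O[at_right 0](\<lambda>\<epsilon>::real. 1 / \<epsilon> ^ k)" if "i \<le> k" for i k
    proof (rule bigoI[where c = 1])
      show "\<forall>\<^sub>F \<epsilon>::real in at_right 0. norm (1 / \<epsilon> ^ i) \<le> 1 * norm (1 / \<epsilon> ^ k)"
        using eventually_at_right_0_unit_interval
        by eventually_elim (use that in \<open>auto intro!: divide_left_mono power_decreasing\<close>)
    qed
    obtain i j where "C \<in> O[at_right 0](\<lambda>\<epsilon>. 1 / \<epsilon> ^ i)" "D \<in> O[at_right 0](\<lambda>\<epsilon>. 1 / \<epsilon> ^ j)"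
      using CD unfolding moderate_net_def by blast
    then have "C \<in> O[at_right 0](\<lambda>\<epsilon>. 1 / \<epsilon> ^ max i j)" "D \<in> O[at_right 0](\<lambda>\<epsilon>. 1 / \<epsilon> ^ max i j)"
      using landau_o.big_trans mono by (meson max.cobounded1 max.cobounded2)+
    then show ?thesis unfolding moderate_net_def by (intro exI sum_in_bigo) simp_all
  qed
qed

text \<open>The maximum is the convenient common bound: its \<open>q\<close>-th power is one of the two given powers.\<close>

lemma slow_scale_net_max:
  assumes "slow_scale_net k" "slow_scale_net l"
  shows "slow_scale_net (\<lambda>\<epsilon>. max (k \<epsilon>) (l \<epsilon>))"
proof -
  note k = assms(1)[unfolded slow_scale_net_def] and l = assms(2)[unfolded slow_scale_net_def]
  have "(INF \<epsilon>\<in>{0<..1}. k \<epsilon>) \<le> (INF \<epsilon>\<in>{0<..1}. max (k \<epsilon>) (l \<epsilon>))"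
  proof (rule cINF_mono)
    show "bdd_below (k ` {0<..1})" using k by (intro bdd_belowI2[where m = 0]) (auto intro: less_imp_le)
  qed (auto intro: bexI[rotated])
  moreover have "0 \<le> (INF \<epsilon>\<in>{0<..1}. k \<epsilon>)"
    using k by (intro cINF_greatest) (auto intro: less_imp_le)
  ultimately have inf: "(INF \<epsilon>\<in>{0<..1}. max (k \<epsilon>) (l \<epsilon>)) \<noteq> 0" using k by linarith
  have "\<exists>c>0. \<forall>\<epsilon>\<in>{0<..1}. max (k \<epsilon>) (l \<epsilon>) powr q \<le> c * inverse \<epsilon>" if q: "q \<ge> 0" for q
  proof -
    obtain c where c: "c > 0" "\<And>\<epsilon>. \<epsilon> \<in> {0<..1} \<Longrightarrow> k \<epsilon> powr q \<le> c * inverse \<epsilon>" using k q by blast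
    obtain d where d: "d > 0" "\<And>\<epsilon>. \<epsilon> \<in> {0<..1} \<Longrightarrow> l \<epsilon> powr q \<le> d * inverse \<epsilon>" using l q by blast
    have "max (k \<epsilon>) (l \<epsilon>) powr q \<le> (c + d) * inverse \<epsilon>" if "\<epsilon> \<in> {0<..1}" for \<epsilon>
      using c(1) d(1) c(2)[OF that] d(2)[OF that] that
      by (auto simp: max_def distrib_right intro: add_increasing add_increasing2)
    then show ?thesis using c(1) d(1) by (intro exI[of _ "c + d"]) auto
  qed
  then show ?thesis using inf k unfolding slow_scale_net_def by (auto simp: less_max_iff_disj)
qed

lemma slow_scale_net_class: "net_class slow_scale_type"
proof
  have "slow_scale_net (\<lambda>_. 1)"
    unfolding slow_scale_net_def by (auto intro!: exI[of _ 1] simp: one_le_inverse)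
  then show "slow_scale_type (\<lambda>_. 0)" unfolding slow_scale_type_def by (intro exI conjI) auto
  show "slow_scale_type D" if "slow_scale_type C" "D \<in> O[at_right 0](C)" for C D
    using that landau_o.big_trans unfolding slow_scale_type_def by blast
  show "slow_scale_type (\<lambda>\<epsilon>. \<bar>C \<epsilon>\<bar> + \<bar>D \<epsilon>\<bar>)" if CD: "slow_scale_type C" "slow_scale_type D" for C D
  proof -
    obtain k l where kl: "slow_scale_net k" "slow_scale_net l" "C \<in> O[at_right 0](k)" "D \<in> O[at_right 0](l)"
      using CD unfolding slow_scale_type_def by blast
    let ?m = "\<lambda>\<epsilon>. max (k \<epsilon>) (l \<epsilon>)"
    have pos: "k \<epsilon> > 0" "l \<epsilon> > 0" if "\<epsilon> \<in> {0<..1}" for \<epsilon>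
      using kl(1,2) that unfolding slow_scale_net_def by auto
    have "k \<in> O[at_right 0](?m)"
      by (rule bigoI[where c = 1], rule eventually_mono[OF eventually_at_right_0_unit_interval]) (use pos in force)
    moreover have "l \<in> O[at_right 0](?m)"
      by (rule bigoI[where c = 1], rule eventually_mono[OF eventually_at_right_0_unit_interval]) (use pos in force)
    ultimately have "C \<in> O[at_right 0](?m)" "D \<in> O[at_right 0](?m)"
      using kl(3,4) landau_o.big_trans by blast+
    then have "(\<lambda>\<epsilon>. \<bar>C \<epsilon>\<bar> + \<bar>D \<epsilon>\<bar>) \<in> O[at_right 0](?m)" by (intro sum_in_bigo) simp_all
    then show ?thesis using slow_scale_net_max[OF kl(1,2)] unfolding slow_scale_type_def by blast
  qed
qed

interpretation moderate: net_class moderate_net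
  by (rule moderate_net_class)

interpretation slow_scale: net_class slow_scale_type
  by (rule slow_scale_net_class)

lemma moderate_symbols_eq: "moderate_symbols = moderate.symbol_nets"
  by (simp add: fun_eq_iff moderate_symbols_def moderate_nets_of_def moderate.symbol_nets_def)

lemma slow_scale_symbols_eq: "slow_scale_symbols = slow_scale.symbol_nets"
  by (simp add: fun_eq_iff slow_scale_symbols_def slow_scale_nets_of_def slow_scale.symbol_nets_def)

theorem proposition2p3:
  fixes \<Omega> :: "(real^'n) set" and \<rho> \<delta> m :: real and ms :: "nat \<Rightarrow> real"
  assumes "open \<Omega>"
    and "\<rho> \<in> {0..1}" and "\<delta> \<in> {0..1}"
    and "decseq ms" and "filterlim ms at_bot sequentially" and "ms 0 = m"
  shows
    "(\<forall>(as :: nat \<Rightarrow> real \<Rightarrow> (real^'n) \<times> (real^'p) \<Rightarrow> complex) a.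
        (\<forall>j. as j \<in> moderate_symbols \<rho> \<delta> \<Omega> (ms j)) \<longrightarrow>
        (\<forall>\<epsilon>\<in>{0<..1}. smooth_on (\<Omega> \<times> UNIV) (a \<epsilon>)) \<longrightarrow>
        (\<forall>K \<alpha> \<beta>. compact K \<and> K \<subseteq> \<Omega> \<longrightarrow>
           (\<exists>\<mu> C. moderate_net C \<and>
             (\<forall>x\<in>K. \<forall>\<xi>. \<forall>\<epsilon>\<in>{0<..1}.
                norm (sym_deriv \<alpha> \<beta> (a \<epsilon>) (x, \<xi>)) \<le> C \<epsilon> * japanese_bracket \<xi> powr \<mu>))) \<longrightarrow>
        (\<forall>K. compact K \<and> K \<subseteq> \<Omega> \<longrightarrow>
           (\<exists>\<mu> :: nat \<Rightarrow> real. filterlim \<mu> at_bot sequentially \<and>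
             (\<forall>r\<ge>1. \<exists>C. moderate_net C \<and>
               (\<forall>x\<in>K. \<forall>\<xi>. \<forall>\<epsilon>\<in>{0<..1}.
                  norm (a \<epsilon> (x, \<xi>) - (\<Sum>j<r. as j \<epsilon> (x, \<xi>))) \<le>
                    C \<epsilon> * japanese_bracket \<xi> powr \<mu> r)))) \<longrightarrow>
        asymp_expansion \<rho> \<delta> \<Omega> ms a as)
     \<and>
     (\<forall>(as :: nat \<Rightarrow> real \<Rightarrow> (real^'n) \<times> (real^'p) \<Rightarrow> complex) a.
        (\<forall>j. as j \<in> slow_scale_symbols \<rho> \<delta> \<Omega> (ms j)) \<longrightarrow>
        (\<forall>\<epsilon>\<in>{0<..1}. smooth_on (\<Omega> \<times> UNIV) (a \<epsilon>)) \<longrightarrow>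
        (\<forall>K \<alpha> \<beta>. compact K \<and> K \<subseteq> \<Omega> \<longrightarrow>
           (\<exists>\<mu> C. slow_scale_type C \<and>
             (\<forall>x\<in>K. \<forall>\<xi>. \<forall>\<epsilon>\<in>{0<..1}.
                norm (sym_deriv \<alpha> \<beta> (a \<epsilon>) (x, \<xi>)) \<le> C \<epsilon> * japanese_bracket \<xi> powr \<mu>))) \<longrightarrow>
        (\<forall>K. compact K \<and> K \<subseteq> \<Omega> \<longrightarrow>
           (\<exists>\<mu> :: nat \<Rightarrow> real. filterlim \<mu> at_bot sequentially \<and>
             (\<forall>r\<ge>1. \<exists>C. slow_scale_type C \<and>
               (\<forall>x\<in>K. \<forall>\<xi>. \<forall>\<epsilon>\<in>{0<..1}.
                  norm (a \<epsilon> (x, \<xi>) - (\<Sum>j<r. as j \<epsilon> (x, \<xi>))) \<le>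
                    C \<epsilon> * japanese_bracket \<xi> powr \<mu> r)))) \<longrightarrow>
        asymp_expansion_sc \<rho> \<delta> \<Omega> ms a as)"
  unfolding asymp_expansion_def asymp_expansion_sc_def moderate_symbols_eq slow_scale_symbols_eq
proof (intro conjI allI impI, goal_cases)
  case (1 "as" a r)
  show ?case
    by (rule moderate.asymptotic_expansion[OF assms(1) assms(4)])
      (use 1 in \<open>auto simp: moderate.weight_bounded_def\<close>)
next
  case (2 "as" a r)
  show ?case
    by (rule slow_scale.asymptotic_expansion[OF assms(1) assms(4)])
      (use 2 in \<open>auto simp: slow_scale.weight_bounded_def\<close>)
qed

end
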